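(* Let $\mathfrak g$ be a finite-dimensional Lie algebra over $\mathbb K=\mathbb R$ or $\mathbb C$ endowed with an ad-invariant metric $g$ such that the metric Nikolayevsky derivation $N$ of $(\mathfrak g,g)$ is nonzero, singular and has nonnegative eigenvalues. Then $(\mathfrak g,g)$ is isometric (via a Lie algebra isomorphism) to a double extension $\mathfrak h\oplus\mathfrak d\oplus\mathfrak h^*$ with $\mathfrak h=\ker N$ and $g_{\mathfrak h}=0$.
   Context: A metric on a Lie algebra is a nondegenerate symmetric $\mathbb K$-bilinear form $g$; it is ad-invariant if $g([X,Y],Z)=-g(Y,[X,Z])$ for all $X,Y,Z$. Let $\mathfrak{co}(\mathfrak g,g)=\{f\in\mathfrak{gl}(\mathfrak g): \exists\, l\in\mathbb K,\ g(fX,Y)+g(X,fY)=l\,g(X,Y)\ \forall X,Y\in\mathfrak g\}$. A metric Nikolayevsky derivation of $(\mathfrak g,g)$ is a semisimple (diagonalizable over $\mathbb C$) derivation $N\in\mathfrak{co}(\mathfrak g,g)\cap\mathrm{Der}(\mathfrak g)$ such that $\mathrm{tr}(N\psi)=\mathrm{tr}(\psi)$ for every $\psi\in\mathfrak{co}(\mathfrak g,g)\cap\mathrm{Der}(\mathfrak g)$. Such an $N$ always exists, has rational eigenvalues, and is unique up to conjugation by automorphisms of $\mathfrak g$ preserving $g$ up to a scalar factor. Double extension: given a Lie algebra $\mathfrak d$ with an ad-invariant metric $g_{\mathfrak d}$, a Lie algebra $\mathfrak h$, and a representation $\pi\colon\mathfrak h\to\mathrm{Der}(\mathfrak d)\cap\mathfrak{so}(\mathfrak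 d,g_{\mathfrak d})$ by skew-adjoint derivations, the double extension is the vector space $\mathfrak q=\mathfrak h\oplus\mathfrak d\oplus\mathfrak h^*$ with Lie bracket $$[(H,X,\alpha),(H',X',\alpha')]=\big([H,H']_{\mathfrak h},\,[X,X']_{\mathfrak d}+\pi(H)X'-\pi(H')X,\,\beta(X,X')+\mathrm{ad}^*_{\mathfrak h}(H)\alpha'-\mathrm{ad}^*_{\mathfrak h}(H')\alpha\big),$$ where $\mathrm{ad}^*_{\mathfrak h}(H)\alpha=-\alpha\circ\mathrm{ad}_H$ and $\beta(X,X')(H)=g_{\mathfrak d}(\pi(H)X,X')$. For any (possibly degenerate) ad-invariant symmetric bilinear form $g_{\mathfrak h}$ on $\mathfrak h$, it carries the ad-invariant metric $\tilde g((H,X,\alpha),(H',X',\alpha'))=g_{\mathfrak h}(H,H')+g_{\mathfrak d}(X,X')+\alpha(H')+\alpha'(H)$. *)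

theory Defs
  imports
    "HOL-Library.Function_Algebras"
    "HOL-Library.Product_Plus"
    "Jordan_Normal_Form.Char_Poly"
begin

text \<open>
  Up to isomorphism the fields in this class are exactly the real and the complex numbers.  The
  embedding is used to speak of complex eigenvalues of endomorphisms over either field.
\<close>

class real_or_complex = Fields.field +
  fixes to_complex :: "'a \<Rightarrow> complex"
  assumes to_complex_add: "to_complex (x + y) = to_complex x + to_complex y"
    and to_complex_mult: "to_complex (x * y) = to_complex x * to_complex y"
    and to_complex_one: "to_complex 1 = 1"
    and range_to_complex: "range to_complex = \<real> \<or> range to_complex = UNIV"

instantiation real :: real_or_complex
begin
definition to_complex_real :: "real \<Rightarrow> complex" where "to_complex_real = complex_of_real"
instance by standard (auto simp: to_complex_real_def Reals_def)
end

instantiation complex :: real_or_complex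
begin
definition to_complex_complex :: "complex \<Rightarrow> complex" where "to_complex_complex = id"
instance by standard (auto simp: to_complex_complex_def)
end

text \<open>
  Vector spaces are given as subspaces of a type; a map between them is a function between the
  ambient types of which only the restriction to the subspace matters.
\<close>

definition linear_on ::
  "('k \<Rightarrow> 'a \<Rightarrow> 'a) \<Rightarrow> ('k \<Rightarrow> 'b \<Rightarrow> 'b) \<Rightarrow> 'a set \<Rightarrow> 'b set \<Rightarrow> ('a::plus \<Rightarrow> 'b::plus) \<Rightarrow> bool"
  where "linear_on s t U V f \<longleftrightarrow>
    f ` U \<subseteq> V \<and> (\<forall>x\<in>U. \<forall>y\<in>U. f (x + y) = f x + f y) \<and> (\<forall>c. \<forall>x\<in>U. f (s c x) = t c (f x))"

definition bilinear_on ::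
  "('k \<Rightarrow> 'a \<Rightarrow> 'a) \<Rightarrow> ('k \<Rightarrow> 'b \<Rightarrow> 'b) \<Rightarrow> 'a set \<Rightarrow> 'b set \<Rightarrow> ('a::plus \<Rightarrow> 'a \<Rightarrow> 'b::plus) \<Rightarrow> bool"
  where "bilinear_on s t U V f \<longleftrightarrow>
    (\<forall>x\<in>U. linear_on s t U V (f x)) \<and> (\<forall>y\<in>U. linear_on s t U V (\<lambda>x. f x y))"

text \<open>
  Functionals on a subspace are extended by zero, so that each one is represented by exactly one
  function.
\<close>

definition dual_space :: "('k::Fields.field \<Rightarrow> 'a::plus \<Rightarrow> 'a) \<Rightarrow> 'a set \<Rightarrow> ('a \<Rightarrow> 'k) set"
  where "dual_space s U = {\<alpha>. linear_on s (*) U UNIV \<alpha> \<and> (\<forall>x. x \<notin> U \<longrightarrow> \<alpha> x = 0)}"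

context vector_space
begin

text \<open>
  The three notions based on the matrix of an endomorphism of a finite-dimensional space (trace,
  diagonalizability over the complex numbers, complex eigenvalues) are invariant under similarity,
  hence do not depend on the choice of the ordered basis.
\<close>

definition basis_list :: "'b list"
  where "basis_list = (SOME bs. distinct bs \<and> independent (set bs) \<and> span (set bs) = UNIV)"

definition endo_matrix :: "('b \<Rightarrow> 'b) \<Rightarrow> 'a mat"
  where "endo_matrix f = mat (length local.basis_list) (length local.basis_list)
    (\<lambda>(i, j). representation (set local.basis_list) (f (local.basis_list ! j)) (local.basis_list ! i))"

definition endo_trace :: "('b \<Rightarrow> 'b) \<Rightarrow> 'a"
  where "endo_trace f = (\<Sum>i<dim_row (local.endo_matrix f). local.endo_matrix f $$ (i, i))"

end

lemma (in finite_dimensional_vector_space) basis_list: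
  "distinct local.basis_list" "independent (set local.basis_list)" "span (set local.basis_list) = UNIV"
proof -
  obtain bs where "set bs = Basis" "distinct bs"
    using finite_distinct_list finite_Basis by blast
  hence "\<exists>bs. distinct bs \<and> independent (set bs) \<and> span (set bs) = UNIV"
    using independent_Basis span_Basis by blast
  from someI_ex[OF this] show
    "distinct local.basis_list" "independent (set local.basis_list)" "span (set local.basis_list) = UNIV"
    unfolding basis_list_def by blast+
qed

definition complex_matrix :: "('k::real_or_complex \<Rightarrow> 'a::ab_group_add \<Rightarrow> 'a) \<Rightarrow> ('a \<Rightarrow> 'a) \<Rightarrow> complex mat"
  where "complex_matrix s f = map_mat to_complex (vector_space.endo_matrix s f)"

text \<open>Diagonalizability is meant over the complex numbers, also when the ground field is real.\<close>

definition semisimple_endo :: "('k::real_or_complex \<Rightarrow> 'a::ab_group_add \<Rightarrow> 'a) \<Rightarrow> ('a \<Rightarrow> 'a) \<Rightarrow> bool"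
  where "semisimple_endo s f \<longleftrightarrow> (\<exists>D. similar_mat (complex_matrix s f) D \<and> diagonal_mat D)"

definition complex_eigenvalue ::
  "('k::real_or_complex \<Rightarrow> 'a::ab_group_add \<Rightarrow> 'a) \<Rightarrow> ('a \<Rightarrow> 'a) \<Rightarrow> complex \<Rightarrow> bool"
  where "complex_eigenvalue s f \<mu> \<longleftrightarrow> eigenvalue (complex_matrix s f) \<mu>"

locale lie_algebra_on = vector_space s
  for s :: "'k::Fields.field \<Rightarrow> 'a::ab_group_add \<Rightarrow> 'a" +
  fixes L :: "'a set" and br :: "'a \<Rightarrow> 'a \<Rightarrow> 'a"
  assumes subspace: "subspace L"
    and bilinear: "bilinear_on s s L L br"
    and alternating: "X \<in> L \<Longrightarrow> br X X = 0"
    and jacobi: "X \<in> L \<Longrightarrow> Y \<in> L \<Longrightarrow> Z \<in> L \<Longrightarrow>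
      br X (br Y Z) + br Y (br Z X) + br Z (br X Y) = 0"

definition ad_invariant_form_on ::
  "('k::Fields.field \<Rightarrow> 'a::ab_group_add \<Rightarrow> 'a) \<Rightarrow> 'a set \<Rightarrow> ('a \<Rightarrow> 'a \<Rightarrow> 'a) \<Rightarrow> ('a \<Rightarrow> 'a \<Rightarrow> 'k) \<Rightarrow> bool"
  where "ad_invariant_form_on s L br g \<longleftrightarrow>
    bilinear_on s (*) L UNIV g \<and>
    (\<forall>X\<in>L. \<forall>Y\<in>L. g X Y = g Y X) \<and>
    (\<forall>X\<in>L. \<forall>Y\<in>L. \<forall>Z\<in>L. g (br X Y) Z = - g Y (br X Z))"

definition ad_invariant_metric_on ::
  "('k::Fields.field \<Rightarrow> 'a::ab_group_add \<Rightarrow> 'a) \<Rightarrow> 'a set \<Rightarrow> ('a \<Rightarrow> 'a \<Rightarrow> 'a) \<Rightarrow> ('a \<Rightarrow> 'a \<Rightarrow> 'k) \<Rightarrow> bool"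
  where "ad_invariant_metric_on s L br g \<longleftrightarrow>
    ad_invariant_form_on s L br g \<and> (\<forall>X\<in>L. (\<forall>Y\<in>L. g X Y = 0) \<longrightarrow> X = 0)"

definition derivations_on ::
  "('k \<Rightarrow> 'a::plus \<Rightarrow> 'a) \<Rightarrow> 'a set \<Rightarrow> ('a \<Rightarrow> 'a \<Rightarrow> 'a) \<Rightarrow> ('a \<Rightarrow> 'a) set"
  where "derivations_on s L br =
    {f. linear_on s s L L f \<and> (\<forall>X\<in>L. \<forall>Y\<in>L. f (br X Y) = br (f X) Y + br X (f Y))}"

definition so_on ::
  "('k::Fields.field \<Rightarrow> 'a::plus \<Rightarrow> 'a) \<Rightarrow> 'a set \<Rightarrow> ('a \<Rightarrow> 'a \<Rightarrow> 'k) \<Rightarrow> ('a \<Rightarrow> 'a) set"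
  where "so_on s L g =
    {f. linear_on s s L L f \<and> (\<forall>X\<in>L. \<forall>Y\<in>L. g (f X) Y + g X (f Y) = 0)}"

definition co_on ::
  "('k::Fields.field \<Rightarrow> 'a::plus \<Rightarrow> 'a) \<Rightarrow> 'a set \<Rightarrow> ('a \<Rightarrow> 'a \<Rightarrow> 'k) \<Rightarrow> ('a \<Rightarrow> 'a) set"
  where "co_on s L g =
    {f. linear_on s s L L f \<and> (\<exists>l. \<forall>X\<in>L. \<forall>Y\<in>L. g (f X) Y + g X (f Y) = l * g X Y)}"

definition metric_nikolayevsky_derivation ::
  "('k::real_or_complex \<Rightarrow> 'a::ab_group_add \<Rightarrow> 'a) \<Rightarrow> ('a \<Rightarrow> 'a \<Rightarrow> 'a) \<Rightarrow> ('a \<Rightarrow> 'a \<Rightarrow> 'k) \<Rightarrow> ('a \<Rightarrow> 'a) \<Rightarrow> bool"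
  where "metric_nikolayevsky_derivation s br g N \<longleftrightarrow>
    N \<in> co_on s UNIV g \<inter> derivations_on s UNIV br \<and>
    semisimple_endo s N \<and>
    (\<forall>\<psi> \<in> co_on s UNIV g \<inter> derivations_on s UNIV br.
      vector_space.endo_trace s (N \<circ> \<psi>) = vector_space.endo_trace s \<psi>)"

definition metric_lie_isomorphism ::
  "('k \<Rightarrow> 'a::plus \<Rightarrow> 'a) \<Rightarrow> 'a set \<Rightarrow> ('a \<Rightarrow> 'a \<Rightarrow> 'a) \<Rightarrow> ('a \<Rightarrow> 'a \<Rightarrow> 'k) \<Rightarrow>
   ('k \<Rightarrow> 'b::plus \<Rightarrow> 'b) \<Rightarrow> 'b set \<Rightarrow> ('b \<Rightarrow> 'b \<Rightarrow> 'b) \<Rightarrow> ('b \<Rightarrow> 'b \<Rightarrow> 'k) \<Rightarrow> ('a \<Rightarrow> 'b) \<Rightarrow> bool"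
  where "metric_lie_isomorphism s L br g t M br' g' \<Phi> \<longleftrightarrow>
    linear_on s t L M \<Phi> \<and> bij_betw \<Phi> L M \<and>
    (\<forall>X\<in>L. \<forall>Y\<in>L. \<Phi> (br X Y) = br' (\<Phi> X) (\<Phi> Y)) \<and>
    (\<forall>X\<in>L. \<forall>Y\<in>L. g' (\<Phi> X) (\<Phi> Y) = g X Y)"

locale double_extension_data =
  h: lie_algebra_on sh H brH + d: lie_algebra_on sd D brD
  for sh :: "'k::Fields.field \<Rightarrow> 'h::ab_group_add \<Rightarrow> 'h" and H and brH
    and sd :: "'k \<Rightarrow> 'd::ab_group_add \<Rightarrow> 'd" and D and brD +
  fixes gD :: "'d \<Rightarrow> 'd \<Rightarrow> 'k" and \<pi> :: "'h \<Rightarrow> 'd \<Rightarrow> 'd" and gH :: "'h \<Rightarrow> 'h \<Rightarrow> 'k"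
  assumes metric_d: "ad_invariant_metric_on sd D brD gD"
    and form_h: "ad_invariant_form_on sh H brH gH"
    and rep_into: "A \<in> H \<Longrightarrow> \<pi> A \<in> derivations_on sd D brD \<inter> so_on sd D gD"
    and rep_linear: "X \<in> D \<Longrightarrow> linear_on sh sd H D (\<lambda>A. \<pi> A X)"
    and rep_bracket: "A \<in> H \<Longrightarrow> B \<in> H \<Longrightarrow> X \<in> D \<Longrightarrow>
      \<pi> (brH A B) X = \<pi> A (\<pi> B X) - \<pi> B (\<pi> A X)"

definition dext_carrier ::
  "('k::Fields.field \<Rightarrow> 'h::plus \<Rightarrow> 'h) \<Rightarrow> 'h set \<Rightarrow> 'd set \<Rightarrow> ('h \<times> 'd \<times> ('h \<Rightarrow> 'k)) set"
  where "dext_carrier sh H D = H \<times> D \<times> dual_space sh H"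

definition dext_scale ::
  "('k::Fields.field \<Rightarrow> 'h \<Rightarrow> 'h) \<Rightarrow> ('k \<Rightarrow> 'd \<Rightarrow> 'd) \<Rightarrow> 'k \<Rightarrow> 'h \<times> 'd \<times> ('h \<Rightarrow> 'k) \<Rightarrow> 'h \<times> 'd \<times> ('h \<Rightarrow> 'k)"
  where "dext_scale sh sd c = (\<lambda>(A, X, \<alpha>). (sh c A, sd c X, \<lambda>C. c * \<alpha> C))"

definition coadjoint ::
  "'h set \<Rightarrow> ('h \<Rightarrow> 'h \<Rightarrow> 'h) \<Rightarrow> 'h \<Rightarrow> ('h \<Rightarrow> 'k::Fields.field) \<Rightarrow> 'h \<Rightarrow> 'k"
  where "coadjoint H brH A \<alpha> = (\<lambda>C. if C \<in> H then - \<alpha> (brH A C) else 0)"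

definition dext_cocycle ::
  "'h set \<Rightarrow> ('d \<Rightarrow> 'd \<Rightarrow> 'k::Fields.field) \<Rightarrow> ('h \<Rightarrow> 'd \<Rightarrow> 'd) \<Rightarrow> 'd \<Rightarrow> 'd \<Rightarrow> 'h \<Rightarrow> 'k"
  where "dext_cocycle H gD \<pi> X X' = (\<lambda>C. if C \<in> H then gD (\<pi> C X) X' else 0)"

definition dext_bracket ::
  "'h set \<Rightarrow> ('h \<Rightarrow> 'h \<Rightarrow> 'h) \<Rightarrow> ('d::ab_group_add \<Rightarrow> 'd \<Rightarrow> 'd) \<Rightarrow> ('d \<Rightarrow> 'd \<Rightarrow> 'k::Fields.field) \<Rightarrow>
   ('h \<Rightarrow> 'd \<Rightarrow> 'd) \<Rightarrow> 'h \<times> 'd \<times> ('h \<Rightarrow> 'k) \<Rightarrow> 'h \<times> 'd \<times> ('h \<Rightarrow> 'k) \<Rightarrow> 'h \<times> 'd \<times> ('h \<Rightarrow> 'k)"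
  where "dext_bracket H brH brD gD \<pi> = (\<lambda>(A, X, \<alpha>) (A', X', \<alpha>').
    (brH A A',
     brD X X' + \<pi> A X' - \<pi> A' X,
     dext_cocycle H gD \<pi> X X' + coadjoint H brH A \<alpha>' - coadjoint H brH A' \<alpha>))"

definition dext_metric ::
  "('h \<Rightarrow> 'h \<Rightarrow> 'k::Fields.field) \<Rightarrow> ('d \<Rightarrow> 'd \<Rightarrow> 'k) \<Rightarrow>
   'h \<times> 'd \<times> ('h \<Rightarrow> 'k) \<Rightarrow> 'h \<times> 'd \<times> ('h \<Rightarrow> 'k) \<Rightarrow> 'k"
  where "dext_metric gH gD = (\<lambda>(A, X, \<alpha>) (A', X', \<alpha>'). gH A A' + gD X X' + \<alpha> A' + \<alpha>' A)"

end

theory Submission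
  imports Defs
begin

text \<open>
  Since \<open>N\<close> is semisimple with real eigenvalues, the algebra is graded by the eigenspaces \<open>V a\<close> of \<open>N\<close>, and
  \<open>g\<close> pairs \<open>V a\<close> with \<open>V (l - a)\<close>, where \<open>l\<close> is the conformal factor of \<open>N\<close>.  Nonnegativity of the
  eigenvalues confines them to \<open>{0..l}\<close>, and \<open>l = 0\<close> would force \<open>N = 0\<close>.  Hence \<open>V 0\<close> and \<open>V l\<close> are
  isotropic and dual to each other, \<open>V l\<close> commutes with all \<open>V a\<close> with \<open>a > 0\<close>, and the sum \<open>D\<close> of the
  intermediate eigenspaces is a Lie algebra under the bracket followed by projection along
  \<open>V 0\<close> and \<open>V l\<close>.  The algebra is then the double extension of \<open>D\<close> by \<open>V 0\<close> acting through the adjoint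
  representation.
\<close>

section \<open>Coordinates and complex eigenfunctionals of a semisimple endomorphism\<close>

lemma field_hom_to_complex: "field_hom (to_complex :: 'k::real_or_complex \<Rightarrow> complex)"
proof -
  have z: "to_complex (0::'k) = 0"
    using to_complex_add[of "0::'k" 0] by simp
  show ?thesis
    by unfold_locales (simp_all add: z to_complex_add to_complex_mult to_complex_one)
qed

context finite_dimensional_vector_space
begin

definition coords :: "'b \<Rightarrow> 'a vec"
  where "coords X = vec (length local.basis_list)
    (\<lambda>i. representation (set local.basis_list) X (local.basis_list ! i))"

lemma coords_carrier [simp]: "coords X \<in> carrier_vec (length local.basis_list)"
  by (simp add: coords_def)

lemma in_span_basis_list [simp]: "X \<in> span (set local.basis_list)"
  by (simp add: basis_list)

lemma coords_add: "coords (X + Y) = coords X + coords Y"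
  by (rule eq_vecI) (simp_all add: coords_def representation_add basis_list)

lemma coords_scale: "coords (scale c X) = c \<cdot>\<^sub>v coords X"
  by (rule eq_vecI) (simp_all add: coords_def representation_scale basis_list)

lemma sum_coords: "(\<Sum>i<length local.basis_list. scale (coords X $ i) (local.basis_list ! i)) = X"
proof -
  have "X = (\<Sum>b\<in>set local.basis_list. scale (representation (set local.basis_list) X b) b)"
    by (rule sum_representation_eq[symmetric]) (simp_all add: basis_list)
  also have "\<dots> = (\<Sum>i<length local.basis_list.
      scale (representation (set local.basis_list) X (local.basis_list ! i)) (local.basis_list ! i))"
    by (rule sum.reindex_bij_betw[symmetric]) (rule bij_betw_nth, simp_all add: basis_list)
  finally show ?thesis by (simp add: coords_def)
qed

lemma coords_eq_0: "coords X = 0\<^sub>v (length local.basis_list) \<Longrightarrow> X = 0"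
  using sum_coords[of X] by simp

lemma coords_endo:
  assumes "Vector_Spaces.linear scale scale f"
  shows "coords (f X) = endo_matrix f *\<^sub>v coords X"
proof (rule eq_vecI)
  interpret f: Vector_Spaces.linear scale scale f by fact
  let ?n = "length local.basis_list"
  fix i assume "i < dim_vec (endo_matrix f *\<^sub>v coords X)"
  hence i: "i < ?n" by (simp add: endo_matrix_def)
  have "coords (f X) $ i
      = representation (set local.basis_list)
          (\<Sum>j<?n. scale (coords X $ j) (f (local.basis_list ! j))) (local.basis_list ! i)"
    using i arg_cong[OF sum_coords[of X], of f] by (simp add: coords_def f.sum f.scale)
  also have "\<dots> = (\<Sum>j<?n. coords X $ j *
      representation (set local.basis_list) (f (local.basis_list ! j)) (local.basis_list ! i))"
    by (simp add: representation_sum representation_scale basis_list)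
  also have "\<dots> = (endo_matrix f *\<^sub>v coords X) $ i"
    using i by (simp add: endo_matrix_def coords_def scalar_prod_def lessThan_atLeast0 mult.commute)
  finally show "coords (f X) $ i = (endo_matrix f *\<^sub>v coords X) $ i" .
qed (simp add: endo_matrix_def coords_def)

end

text \<open>Diagonalization \<open>Q * M = D * Q\<close> makes the rows of \<open>Q\<close> left
  eigenvectors of the complex matrix. Applied to coordinates, they are complex-valued functionals on
  the space itself, so a real space need not be complexified; they separate points because
  \<open>Q\<close> is invertible.\<close>

lemma semisimple_endo_eigenfunctionals:
  fixes s :: "'k::real_or_complex \<Rightarrow> 'a::ab_group_add \<Rightarrow> 'a"
  assumes "finite_dimensional_vector_space s Basis"
    and lin: "Vector_Spaces.linear s s f"
    and "semisimple_endo s f"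
  obtains n :: nat and \<mu> :: "nat \<Rightarrow> complex" and \<phi> :: "nat \<Rightarrow> 'a \<Rightarrow> complex"
  where "\<And>i. i < n \<Longrightarrow> complex_eigenvalue s f (\<mu> i)"
    and "\<And>i X Y. i < n \<Longrightarrow> \<phi> i (X + Y) = \<phi> i X + \<phi> i Y"
    and "\<And>i c X. i < n \<Longrightarrow> \<phi> i (s c X) = to_complex c * \<phi> i X"
    and "\<And>i X. i < n \<Longrightarrow> \<phi> i (f X) = \<mu> i * \<phi> i X"
    and "\<And>X. (\<And>i. i < n \<Longrightarrow> \<phi> i X = 0) \<Longrightarrow> X = 0"
proof -
  interpret V: finite_dimensional_vector_space s Basis by fact
  interpret hom: field_hom "to_complex :: 'k \<Rightarrow> complex" by (rule field_hom_to_complex)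
  define n where "n = length (vector_space.basis_list s)"
  define M where "M = complex_matrix s f"
  have A: "V.endo_matrix f \<in> carrier_mat n n"
    by (simp add: V.endo_matrix_def n_def)
  hence M: "M \<in> carrier_mat n n"
    by (simp add: M_def complex_matrix_def)
  obtain D where D: "similar_mat M D" "diagonal_mat D"
    using \<open>semisimple_endo s f\<close> unfolding semisimple_endo_def M_def by blast
  then obtain P Q where "similar_mat_wit M D P Q"
    unfolding similar_mat_def by blast
  note PQ = similar_mat_witD2[OF M this]
  have "Q * M = Q * (P * (D * Q))"
    using PQ(3) assoc_mult_mat[OF PQ(6) PQ(5) PQ(7)] by simp
  also have "\<dots> = Q * P * (D * Q)"
    by (rule assoc_mult_mat[OF PQ(7) PQ(6) mult_carrier_mat[OF PQ(5) PQ(7)], symmetric])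
  also have "\<dots> = D * Q"
    using PQ(5,7) unfolding PQ(2) by (intro left_mult_one_mat) auto
  finally have QM: "Q * M = D * Q" .
  define w where "w X = map_vec to_complex (V.coords X)" for X
  define \<phi> where "\<phi> i X = (Q *\<^sub>v w X) $ i" for i X
  have coords: "V.coords X \<in> carrier_vec n" for X
    by (simp add: n_def)
  have w: "w X \<in> carrier_vec n" for X
    using coords by (simp add: w_def)
  have w_f: "w (f X) = M *\<^sub>v w X" for X
    using hom.mult_mat_vec_hom[OF A coords]
    by (simp add: w_def M_def complex_matrix_def V.coords_endo[OF lin])
  have w_add: "w (X + Y) = w X + w Y" for X Y
    using coords[of X] coords[of Y]
    by (intro eq_vecI) (simp_all add: w_def V.coords_add to_complex_add)
  have w_scale: "w (s c X) = to_complex c \<cdot>\<^sub>v w X" for c X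
    using coords by (simp add: w_def V.coords_scale hom.vec_hom_smult)
  have Q: "dim_row Q = n" "dim_col Q = n" using PQ by auto
  show thesis
  proof (rule that[of n "\<lambda>i. D $$ (i, i)" \<phi>])
    fix i assume i: "i < n"
    \<comment> \<open>Similar matrices share their characteristic polynomial, so the diagonal
      entries of \<open>D\<close> are eigenvalues of \<open>M\<close>.\<close>
    have "upper_triangular D"
      using D(2) PQ(5) unfolding upper_triangular_def diagonal_mat_def by auto
    hence "char_poly M = (\<Prod>a\<leftarrow>diag_mat D. [:- a, 1:])"
      using char_poly_similar[OF D(1)] char_poly_upper_triangular[OF PQ(5)] by simp
    moreover have "D $$ (i, i) \<in> set (diag_mat D)"
      using PQ(5) i by (auto simp: diag_mat_def)
    ultimately have "poly (char_poly M) (D $$ (i, i)) = 0"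
      by (auto simp: poly_prod_list prod_list_zero_iff image_iff)
    thus "complex_eigenvalue s f (D $$ (i, i))"
      unfolding complex_eigenvalue_def using eigenvalue_root_char_poly[OF M] by (simp add: M_def)
    fix X Y c
    show "\<phi> i (X + Y) = \<phi> i X + \<phi> i Y"
      using i w PQ(7) Q by (simp add: \<phi>_def w_add mult_add_distrib_mat_vec[of _ n n])
    show "\<phi> i (s c X) = to_complex c * \<phi> i X"
      using i w Q by (simp add: \<phi>_def w_scale mult_mat_vec[OF PQ(7) w] del: index_mult_mat_vec)
    have "Q *\<^sub>v w (f X) = (Q * M) *\<^sub>v w X"
      unfolding w_f using PQ(7) M w by (simp add: assoc_mult_mat_vec[of _ n n _ n])
    also have "\<dots> = D *\<^sub>v (Q *\<^sub>v w X)"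
      unfolding QM using PQ w by (simp add: assoc_mult_mat_vec[of _ n n _ n])
    finally have "\<phi> i (f X) = row D i \<bullet> (Q *\<^sub>v w X)"
      using i PQ(5) by (simp add: \<phi>_def)
    also have "\<dots> = (\<Sum>j<n. D $$ (i, j) * \<phi> j X)"
      using i PQ(5) Q by (simp add: scalar_prod_def lessThan_atLeast0 \<phi>_def)
    also have "\<dots> = (\<Sum>j<n. if j = i then D $$ (i, i) * \<phi> i X else 0)"
      using i PQ(5) D(2) by (intro sum.cong) (auto simp: diagonal_mat_def)
    finally show "\<phi> i (f X) = D $$ (i, i) * \<phi> i X"
      using i by simp
  next
    fix X assume 0: "\<And>i. i < n \<Longrightarrow> \<phi> i X = 0"
    have "Q *\<^sub>v w X = 0\<^sub>v n"
      using 0 Q by (intro eq_vecI) (auto simp: \<phi>_def)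
    hence "P *\<^sub>v (Q *\<^sub>v w X) = 0\<^sub>v n"
      using PQ by (auto intro: eq_vecI simp: scalar_prod_def)
    hence "w X = 0\<^sub>v n"
      using assoc_mult_mat_vec[OF PQ(6) PQ(7) w[of X]] PQ(1) w[of X] by simp
    hence "to_complex (V.coords X $ i) = 0" if "i < n" for i
      using that coords[of X] by (metis carrier_vecD index_map_vec(1) index_zero_vec(1) w_def)
    hence "V.coords X = 0\<^sub>v n"
      using coords[of X] by (intro eq_vecI) auto
    thus "X = 0"
      using V.coords_eq_0 by (simp add: n_def)
  qed
qed

section \<open>Eigenspace decomposition over the ground field\<close>

text \<open>\<open>E a\<close> is the projection onto the \<open>a\<close>-eigenspace along the
  others, for every scalar \<open>a\<close>; \<open>S\<close> is any finite set whose projections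
  add up to the identity.\<close>

locale eigen_projections = vector_space s
  for s :: "'k::Fields.field \<Rightarrow> 'a::ab_group_add \<Rightarrow> 'a" +
  fixes f :: "'a \<Rightarrow> 'a" and S :: "'k set" and E :: "'k \<Rightarrow> 'a \<Rightarrow> 'a"
  assumes finite_S: "finite S"
    and f_E: "f (E a X) = s a (E a X)"
    and sum_E: "(\<Sum>a\<in>S. E a X) = X"
    and E_add: "E a (X + Y) = E a X + E a Y"
    and E_scale: "E a (s c X) = s c (E a X)"
    and E_eigen: "f X = s b X \<Longrightarrow> E a X = (if a = b then X else 0)"

text \<open>Here \<open>rational\<close> means that the complex eigenvalues come from the ground
  field. The projections are then polynomials in \<open>f\<close> over that field, and the
  separating functionals \<phi> verify their identities.\<close>

lemma semisimple_endo_eigen_projections: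
  fixes s :: "'k::real_or_complex \<Rightarrow> 'a::ab_group_add \<Rightarrow> 'a"
  assumes fin: "finite_dimensional_vector_space s Basis"
    and lin: "Vector_Spaces.linear s s f"
    and ss: "semisimple_endo s f"
    and rational: "\<And>z. complex_eigenvalue s f z \<Longrightarrow> z \<in> range (to_complex :: 'k \<Rightarrow> complex)"
  obtains S E where "eigen_projections s f S E"
    and "\<And>a. a \<in> S \<Longrightarrow> complex_eigenvalue s f (to_complex a)"
proof -
  interpret V: finite_dimensional_vector_space s Basis by fact
  interpret hom: field_hom "to_complex :: 'k \<Rightarrow> complex" by (rule field_hom_to_complex)
  obtain n :: nat and \<mu> and \<phi> :: "nat \<Rightarrow> 'a \<Rightarrow> complex" where \<mu>: "\<And>i. i < n \<Longrightarrow> complex_eigenvalue s f (\<mu> i)"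
    and \<phi>_add: "\<And>i X Y. i < n \<Longrightarrow> \<phi> i (X + Y) = \<phi> i X + \<phi> i Y"
    and \<phi>_scale: "\<And>i c X. i < n \<Longrightarrow> \<phi> i (s c X) = to_complex c * \<phi> i X"
    and \<phi>_f: "\<And>i X. i < n \<Longrightarrow> \<phi> i (f X) = \<mu> i * \<phi> i X"
    and \<phi>_0: "\<And>X. (\<And>i. i < n \<Longrightarrow> \<phi> i X = 0) \<Longrightarrow> X = 0"
  proof (rule semisimple_endo_eigenfunctionals[OF fin lin ss], goal_cases)
    case (1 n \<mu> \<phi>)
    show ?case by (rule 1(1)) (fact 1)+
  qed
  have \<phi>_diff: "\<phi> i (X - Y) = \<phi> i X - \<phi> i Y" if "i < n" for i X Y
    using \<phi>_add[OF that, of "X - Y" Y] by simp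
  have \<phi>_zero: "\<phi> i 0 = 0" if "i < n" for i
    using \<phi>_add[OF that, of 0 0] by simp
  have \<phi>_eqI: "X = Y" if "\<And>i. i < n \<Longrightarrow> \<phi> i X = \<phi> i Y" for X Y
    using \<phi>_0[of "X - Y"] that by (simp add: \<phi>_diff)
  have \<phi>_sum: "\<phi> i (\<Sum>a\<in>A. F a) = (\<Sum>a\<in>A. \<phi> i (F a))" if "i < n" "finite A"
    for i and A :: "'k set" and F
    using that(2) by induction (simp_all add: \<phi>_add[OF that(1)] \<phi>_zero[OF that(1)])
  define S where "S = {a :: 'k. to_complex a \<in> \<mu> ` {..<n}}"
  have fin_S: "finite S"
    unfolding S_def using finite_vimageI[OF _ hom.inj_f, of "\<mu> ` {..<n}"] by (simp add: vimage_def)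
  have \<mu>_S: "\<exists>a\<in>S. to_complex a = \<mu> i" if "i < n" for i
    using rational[OF \<mu>[OF that]] that unfolding S_def by (metis (mono_tags) imageI lessThan_iff mem_Collect_eq rangeE)
  \<comment> \<open>Lagrange interpolation, one factor at a time: applying
    \<open>(f - b) / (a - b)\<close> keeps the part of eigenvalue \<open>a\<close> and kills the
    part of eigenvalue \<open>b\<close>.\<close>
  have ex_avoiding: "\<exists>W. \<forall>i<n. (\<mu> i = to_complex a \<longrightarrow> \<phi> i W = \<phi> i X) \<and>
      (\<mu> i \<in> to_complex ` T \<longrightarrow> \<phi> i W = 0)" if "finite T" "a \<notin> T" for T and a :: 'k and X
    using that
  proof induction
    case empty
    show ?case by auto
  next
    case (insert b T)
    then obtain W where W: "\<forall>i<n. (\<mu> i = to_complex a \<longrightarrow> \<phi> i W = \<phi> i X) \<and>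
        (\<mu> i \<in> to_complex ` T \<longrightarrow> \<phi> i W = 0)" by auto
    have "\<phi> i (s (inverse (a - b)) (f W - s b W)) =
        inverse (to_complex a - to_complex b) * ((\<mu> i - to_complex b) * \<phi> i W)" if "i < n" for i
      using that by (simp add: \<phi>_scale \<phi>_diff \<phi>_f hom.hom_inverse hom.hom_minus left_diff_distrib)
    moreover have "to_complex a \<noteq> to_complex b"
      using insert.prems by simp
    ultimately show ?case
      using W by (intro exI[of _ "s (inverse (a - b)) (f W - s b W)"]) auto
  qed
  have "\<exists>W. \<forall>i<n. \<phi> i W = (if \<mu> i = to_complex a then \<phi> i X else 0)" for a :: 'k and X
  proof -
    obtain W where W: "\<forall>i<n. (\<mu> i = to_complex a \<longrightarrow> \<phi> i W = \<phi> i X) \<and>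
        (\<mu> i \<in> to_complex ` (S - {a}) \<longrightarrow> \<phi> i W = 0)"
      using ex_avoiding[of "S - {a}" a X] fin_S by auto
    have "\<phi> i W = (if \<mu> i = to_complex a then \<phi> i X else 0)" if "i < n" for i
      using W \<mu>_S[OF that] that by (metis Diff_iff imageI singletonD)
    thus ?thesis by blast
  qed
  then obtain E :: "'k \<Rightarrow> 'a \<Rightarrow> 'a" where
    E: "\<And>a X i. i < n \<Longrightarrow> \<phi> i (E a X) = (if \<mu> i = to_complex a then \<phi> i X else 0)"
    by metis
  have "eigen_projections s f S E"
  proof
    show "finite S" by (rule fin_S)
    fix a b c X Y
    show "f (E a X) = s a (E a X)"
      by (rule \<phi>_eqI) (simp add: \<phi>_f \<phi>_scale E)
    show "(\<Sum>a\<in>S. E a X) = X"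
    proof (rule \<phi>_eqI)
      fix i assume i: "i < n"
      obtain a where a: "a \<in> S" "\<mu> i = to_complex a" using \<mu>_S[OF i] by force
      show "\<phi> i (\<Sum>a\<in>S. E a X) = \<phi> i X"
        using a fin_S by (simp add: \<phi>_sum[OF i] E[OF i] a(2))
    qed
    show "E a (X + Y) = E a X + E a Y"
      by (rule \<phi>_eqI) (simp add: \<phi>_add E)
    show "E a (s c X) = s c (E a X)"
      by (rule \<phi>_eqI) (simp add: \<phi>_scale E)
    assume "f X = s b X"
    hence "\<forall>i<n. \<mu> i = to_complex b \<or> \<phi> i X = 0"
      using \<phi>_f[of _ X] \<phi>_scale[of _ b X] by (metis mult_cancel_right)
    thus "E a X = (if a = b then X else 0)"
      by (intro \<phi>_eqI) (auto simp: E \<phi>_zero)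
  qed
  moreover have "complex_eigenvalue s f (to_complex a)" if "a \<in> S" for a
    using that \<mu> by (auto simp: S_def)
  ultimately show thesis by (rule that)
qed

section \<open>Metric Lie algebras graded by a conformal derivation\<close>

text \<open>The additive real weight \<open>w\<close> replaces an order on the eigenvalues, which an
  abstract field does not carry.\<close>

locale weighted_metric_lie_algebra =
  finite_dimensional_vector_space s Basis + lie_algebra_on s UNIV br + eigen_projections s N S E
  for s :: "'k::Fields.field \<Rightarrow> 'a::ab_group_add \<Rightarrow> 'a" and Basis and br and N and S and E +
  fixes g :: "'a \<Rightarrow> 'a \<Rightarrow> 'k" and l :: 'k and w :: "'k \<Rightarrow> real"
  assumes metric: "ad_invariant_metric_on s UNIV br g"
    and derivation: "N \<in> derivations_on s UNIV br"
    and conformal: "g (N X) Y + g X (N Y) = l * g X Y"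
    and weight_add: "w (a + b) = w a + w b"
    and weight_nonneg: "a \<in> S \<Longrightarrow> 0 \<le> w a"
    and weight_pos: "a \<in> S \<Longrightarrow> a \<noteq> 0 \<Longrightarrow> w a \<noteq> 0"
    and N_nonzero: "N \<noteq> (\<lambda>X. 0)"
begin

lemma br_add_left: "br (X + Y) Z = br X Z + br Y Z"
  and br_add_right: "br Z (X + Y) = br Z X + br Z Y"
  and br_scale_left: "br (s c X) Z = s c (br X Z)"
  and br_scale_right: "br Z (s c X) = s c (br Z X)"
  using bilinear by (simp_all add: bilinear_on_def linear_on_def)

sublocale br_left: additive "\<lambda>X. br X Z" for Z
  by standard (rule br_add_left)

sublocale br_right: additive "\<lambda>X. br Z X" for Z
  by standard (rule br_add_right)

lemma br_commute: "br X Y = - br Y X"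
proof -
  have "br (X + Y) (X + Y) = 0"
    by (rule alternating) simp
  hence "br X Y + br Y X = 0"
    using alternating[of X] alternating[of Y] by (simp add: br_add_left br_add_right add.commute)
  thus ?thesis by (simp add: eq_neg_iff_add_eq_0)
qed

lemma br_leibniz: "br X (br Y Z) = br (br X Y) Z + br Y (br X Z)"
proof -
  have "br X (br Y Z) - br Y (br X Z) + br Z (br X Y) = 0"
    using jacobi[of X Y Z] by (simp add: br_commute[of Z X] br_right.minus)
  thus ?thesis
    by (simp add: br_commute[of "br X Y" Z] algebra_simps)
qed

lemma g_add_left: "g (X + Y) Z = g X Z + g Y Z"
  and g_add_right: "g Z (X + Y) = g Z X + g Z Y"
  and g_scale_left: "g (s c X) Z = c * g X Z"
  and g_scale_right: "g Z (s c X) = c * g Z X"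
  and g_commute: "g X Y = g Y X"
  and g_ad: "g (br X Y) Z = - g Y (br X Z)"
  and g_nondegenerate: "(\<And>Y. g X Y = 0) \<Longrightarrow> X = 0"
  using metric
  unfolding ad_invariant_metric_on_def ad_invariant_form_on_def bilinear_on_def linear_on_def
  by blast+

sublocale g_left: additive "\<lambda>X. g X Z" for Z
  by standard (rule g_add_left)

sublocale g_right: additive "\<lambda>X. g Z X" for Z
  by standard (rule g_add_right)

sublocale N: additive N
  using derivation by unfold_locales (auto simp: derivations_on_def linear_on_def)

lemma N_scale: "N (s c X) = s c (N X)"
  using derivation by (auto simp: derivations_on_def linear_on_def)

lemma N_br: "N (br X Y) = br (N X) Y + br X (N Y)"
  using derivation by (auto simp: derivations_on_def)

sublocale E: additive "E a" for a
  by standard (rule E_add)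

lemma E_E: "E a (E b X) = (if a = b then E b X else 0)"
  by (rule E_eigen) (rule f_E)

text \<open>Lets a sum over \<open>S\<close> collapse to its term at \<open>a\<close> without a case
  distinction on \<open>a \<in> S\<close>.\<close>

lemma E_outside:
  assumes "a \<notin> S"
  shows "E a X = 0"
proof -
  have "E a X = (\<Sum>b\<in>S. E a (E b X))"
    using E.sum[of a "\<lambda>b. E b X" S] by (simp only: sum_E)
  also have "\<dots> = (\<Sum>b\<in>S. 0)"
    using assms by (intro sum.cong refl) (auto simp: E_E)
  finally show ?thesis by simp
qed

lemma E_ker: "N X = 0 \<Longrightarrow> E a X = (if a = 0 then X else 0)"
  using E_eigen[of X 0] by simp

lemma N_E_0: "N (E 0 X) = 0"
  by (simp add: f_E)

lemma weight_0: "w 0 = 0"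
  using weight_add[of 0 0] by simp

lemma g_nonzero_component:
  assumes "X \<noteq> 0"
  obtains b Y where "b \<in> S" "g X (E b Y) \<noteq> 0"
proof -
  obtain Y where Y: "g X Y \<noteq> 0"
    using g_nondegenerate assms by blast
  have "g X Y = (\<Sum>b\<in>S. g X (E b Y))"
    by (subst sum_E[of Y, symmetric]) (rule g_right.sum)
  hence "(\<Sum>b\<in>S. g X (E b Y)) \<noteq> 0"
    using Y by simp
  then obtain b where "b \<in> S" "g X (E b Y) \<noteq> 0"
    by (rule sum.not_neutral_contains_not_neutral)
  thus thesis by (rule that)
qed

text \<open>Conformality reads \<open>(a + b) * g X Y = l * g X Y\<close> on eigenvectors.\<close>

lemma g_eigen:
  assumes "N X = s a X" "N Y = s b Y" "g X Y \<noteq> 0"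
  shows "a + b = l"
  using conformal[of X Y] assms by (simp add: g_scale_left g_scale_right flip: distrib_right)

text \<open>By nondegeneracy \<open>X\<close> pairs with a component of some eigenvalue
  \<open>b\<close> in \<open>S\<close>; then \<open>a + b = l\<close> and \<open>w b\<close> is
  nonnegative.\<close>

lemma eigen_weight:
  assumes "N X = s a X" "X \<noteq> 0"
  shows "a \<in> S" "w a \<le> w l"
proof -
  show "a \<in> S"
    using E_outside[of a X] E_eigen[OF assms(1), of a] assms(2) by auto
  obtain b Y where "b \<in> S" "g X (E b Y) \<noteq> 0"
    using g_nonzero_component[OF assms(2)] .
  with g_eigen[OF assms(1) f_E] show "w a \<le> w l"
    using weight_nonneg[of b] weight_add[of a b] by auto
qed

text \<open>For \<open>l = 0\<close> every eigenvalue would have weight both at least and at most 0,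
  hence be 0, and \<open>N\<close> would vanish.\<close>

lemma l_nonzero: "l \<noteq> 0"
proof
  assume l: "l = 0"
  obtain X where X: "N X \<noteq> 0"
    using N_nonzero by auto
  have "N X = (\<Sum>a\<in>S. N (E a X))"
    by (subst sum_E[of X, symmetric]) (rule N.sum)
  hence "(\<Sum>a\<in>S. N (E a X)) \<noteq> 0"
    using X by simp
  then obtain a where a: "a \<in> S" "N (E a X) \<noteq> 0"
    by (rule sum.not_neutral_contains_not_neutral)
  hence "a \<noteq> 0" "E a X \<noteq> 0"
    using f_E[of a X] by auto
  moreover from this have "w a \<le> 0"
    using eigen_weight(2)[OF f_E] l weight_0 by auto
  ultimately show False
    using weight_nonneg[OF a(1)] weight_pos[OF a(1)] by simp
qed

section \<open>Compatibility of the bracket and the metric with the grading\<close>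

lemma br_eigen:
  assumes "N X = s a X" "N Y = s b Y"
  shows "N (br X Y) = s (a + b) (br X Y)"
  by (simp add: N_br assms br_scale_left br_scale_right scale_left_distrib)

text \<open>The adjoint action of a kernel element preserves each eigenspace, because its own
  eigenvalue is 0.\<close>

lemma E_br_ker:
  assumes "N C = 0"
  shows "E a (br C X) = br C (E a X)"
proof -
  have N: "N (br C (E b X)) = s b (br C (E b X))" for b
    using br_eigen[of C 0 "E b X" b] assms by (simp add: f_E)
  have "E a (br C X) = (\<Sum>b\<in>S. E a (br C (E b X)))"
    by (subst sum_E[of X, symmetric]) (simp only: br_right.sum E.sum)
  also have "\<dots> = (\<Sum>b\<in>S. if a = b then br C (E a X) else 0)"
    by (intro sum.cong refl) (simp add: E_eigen[OF N])
  also have "\<dots> = br C (E a X)"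
    using finite_S E_outside[of a X] by (simp add: br_right.zero)
  finally show ?thesis .
qed

text \<open>Elements without kernel component have only components of positive weight, and weights
  add under the bracket.\<close>

lemma E_0_br:
  assumes "E 0 X = 0" "E 0 Y = 0"
  shows "E 0 (br X Y) = 0"
proof -
  have "br X Y = (\<Sum>b\<in>S. \<Sum>a\<in>S. br (E a X) (E b Y))"
    by (subst sum_E[of X, symmetric], subst sum_E[of Y, symmetric])
       (simp only: br_left.sum br_right.sum)
  moreover have "E 0 (br (E a X) (E b Y)) = 0" if "a \<in> S" "b \<in> S" for a b
  proof (cases "a = 0 \<or> b = 0")
    case True
    thus ?thesis
      using assms by (auto simp: br_left.zero br_right.zero E.zero)
  next
    case False
    hence "a + b \<noteq> 0"
      using that weight_nonneg[of a] weight_nonneg[of b] weight_pos[of a] weight_add[of a b] weight_0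
      by auto
    thus ?thesis
      using E_eigen[OF br_eigen[OF f_E f_E], of 0 a X b Y] by simp
  qed
  ultimately show ?thesis
    by (simp add: E.sum)
qed

text \<open>The eigenvalue \<open>l\<close> has maximal weight, so its eigenspace commutes with all positive ones.\<close>

lemma br_top:
  assumes "E 0 X = 0" "N Z = s l Z"
  shows "br X Z = 0"
proof -
  have "br (E a X) Z = 0" if "a \<in> S" for a
  proof (rule ccontr)
    assume nz: "br (E a X) Z \<noteq> 0"
    hence "a \<noteq> 0"
      using assms(1) by (auto simp: br_left.zero)
    moreover have "w (a + l) \<le> w l"
      using eigen_weight(2)[OF br_eigen[OF f_E assms(2)] nz] .
    ultimately show False
      using weight_nonneg[OF that] weight_pos[OF that] by (simp add: weight_add)
  qed
  moreover have "br X Z = (\<Sum>a\<in>S. br (E a X) Z)"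
    by (subst sum_E[of X, symmetric]) (rule br_left.sum)
  ultimately show ?thesis by simp
qed

text \<open>By \<open>g_eigen\<close>, all components of \<open>X\<close> of eigenvalue other than
  \<open>l - b\<close> are orthogonal to \<open>Y\<close>.\<close>

lemma g_E:
  assumes "N Y = s b Y" "a + b = l"
  shows "g X Y = g (E a X) Y"
proof -
  have "g X Y = (\<Sum>c\<in>S. g (E c X) Y)"
    using g_left.sum[of "\<lambda>c. E c X" S Y] by (simp only: sum_E)
  also have "\<dots> = (\<Sum>c\<in>S. if c = a then g (E a X) Y else 0)"
  proof (intro sum.cong refl)
    fix c
    have "g (E c X) Y = 0 \<or> c + b = a + b"
      using g_eigen[OF f_E assms(1), of c X] assms(2) by metis
    thus "g (E c X) Y = (if c = a then g (E a X) Y else 0)"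
      by auto
  qed
  also have "\<dots> = g (E a X) Y"
    using finite_S E_outside[of a X] by (simp add: g_left.zero)
  finally show ?thesis .
qed

lemma g_ker: "N C = 0 \<Longrightarrow> g X C = g (E l X) C"
  using g_E[of C 0 l] by simp

lemma g_top: "N Z = s l Z \<Longrightarrow> g X Z = g (E 0 X) Z"
  using g_E[of Z l 0] by simp

text \<open>\<open>T\<close> encodes the functional \<open>g Z\<close> as the vector whose
  coefficients are its values on \<open>Basis\<close>. The map into the dual thus becomes an
  endomorphism, for which injectivity implies surjectivity.\<close>

lemma riesz:
  assumes "Vector_Spaces.linear s (*) \<alpha>"
  shows "\<exists>Z. \<forall>Y. g Z Y = \<alpha> Y"
proof -
  define T where "T Z = (\<Sum>b\<in>Basis. s (g Z b) b)" for Z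
  have eq: "g Z Y = h Y"
    if "\<And>b. b \<in> Basis \<Longrightarrow> g Z b = h b" "Vector_Spaces.linear s (*) h" for Z Y and h :: "'a \<Rightarrow> 'k"
  proof -
    interpret h: Vector_Spaces.linear s "(*)" h by fact
    have Y: "(\<Sum>b\<in>Basis. s (representation Basis Y b) b) = Y"
      by (rule sum_representation_eq) (simp_all add: independent_Basis span_Basis finite_Basis)
    have "g Z (\<Sum>b\<in>Basis. s (representation Basis Y b) b) =
        h (\<Sum>b\<in>Basis. s (representation Basis Y b) b)"
      by (simp add: g_right.sum g_scale_right h.sum h.scale that(1))
    thus ?thesis unfolding Y .
  qed
  have coefficients: "\<forall>b\<in>Basis. u b = v b"
    if "(\<Sum>b\<in>Basis. s (u b) b) = (\<Sum>b\<in>Basis. s (v b) b)" for u v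
  proof -
    have "(\<Sum>b\<in>Basis. s (u b - v b) b) = 0"
      using that by (simp add: scale_left_diff_distrib sum_subtractf)
    thus ?thesis
      using independentD[OF independent_Basis finite_Basis subset_refl, of "\<lambda>b. u b - v b"] by auto
  qed
  have lin0: "Vector_Spaces.linear s (*) (\<lambda>Y. 0 :: 'k)"
    by unfold_locales (simp_all add: algebra_simps)
  have T: "Vector_Spaces.linear s s T"
    by (simp add: Vector_Spaces.linear_iff vector_space_axioms T_def g_add_left g_scale_left
        scale_left_distrib sum.distrib scale_sum_right)
  moreover have "inj T"
  proof -
    interpret T: Vector_Spaces.linear s s T by fact
    have "Z = 0" if "T Z = 0" for Z
    proof -
      have "\<forall>b\<in>Basis. g Z b = 0"
        using coefficients[of "g Z" "\<lambda>b. 0"] that by (simp add: T_def)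
      hence "g Z Y = 0" for Y
        using eq[OF _ lin0, of Z Y] by blast
      thus ?thesis by (rule g_nondegenerate)
    qed
    thus ?thesis by (metis T.diff eq_iff_diff_eq_0 injI)
  qed
  ultimately have "surj T"
    by (rule linear_inj_imp_surj)
  then obtain Z where "T Z = (\<Sum>b\<in>Basis. s (\<alpha> b) b)"
    by (metis surjD)
  hence "\<forall>b\<in>Basis. g Z b = \<alpha> b"
    by (intro coefficients) (simp add: T_def)
  hence "g Z Y = \<alpha> Y" for Y
    using eq[OF _ assms, of Z Y] by blast
  thus ?thesis by blast
qed

section \<open>The Lie algebra of the intermediate eigenspaces\<close>

definition middle :: "'a \<Rightarrow> 'a" where "middle X = X - E 0 X - E l X"

definition middle_space :: "'a set" where "middle_space = {X. E 0 X = 0 \<and> E l X = 0}"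

text \<open>On \<open>middle_space\<close> the projection removes only the
  \<open>l\<close>-component, by \<open>E_0_br\<close>. That component is recorded by the cocycle of
  the double extension.\<close>

definition middle_br :: "'a \<Rightarrow> 'a \<Rightarrow> 'a" where "middle_br X Y = middle (br X Y)"

sublocale middle: additive middle
  by standard (simp add: middle_def E_add)

lemma middle_scale: "middle (s c X) = s c (middle X)"
  by (simp add: middle_def E_scale scale_right_diff_distrib)

lemma middle_in [simp]: "middle X \<in> middle_space"
  using l_nonzero by (simp add: middle_def middle_space_def E.diff E_E)

lemma middle_ker: "N X = 0 \<Longrightarrow> middle X = 0"
  using l_nonzero by (simp add: middle_def E_ker)

lemma middle_br_ker: "N C = 0 \<Longrightarrow> middle (br C X) = br C (middle X)"
  by (simp add: middle_def E_br_ker br_right.diff)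

lemma br_ker_middle: "N C = 0 \<Longrightarrow> X \<in> middle_space \<Longrightarrow> br C X \<in> middle_space"
  by (simp add: middle_space_def E_br_ker br_right.zero)

text \<open>The removed components of eigenvalues 0 and \<open>l\<close> pair only with the
  components of \<open>Y\<close> of eigenvalues \<open>l\<close> and 0, which vanish.\<close>

lemma g_middle:
  assumes "Y \<in> middle_space"
  shows "g (middle X) Y = g X Y"
proof -
  have "g (E 0 X) Y = 0"
    using g_ker[OF N_E_0, of Y X] assms
    by (simp add: middle_space_def g_commute[of _ Y] g_left.zero)
  moreover have "g (E l X) Y = 0"
    using g_top[OF f_E, of Y X] assms
    by (simp add: middle_space_def g_commute[of _ Y] g_left.zero)
  ultimately show ?thesis
    by (simp add: middle_def g_left.diff)
qed

text \<open>Only the \<open>l\<close>-component of \<open>Y\<close> is removed, and it commutes with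
  \<open>X\<close> by \<open>br_top\<close>. Inner projections can therefore be dropped from
  iterated brackets.\<close>

lemma middle_br_middle:
  assumes "E 0 X = 0" "E 0 Y = 0"
  shows "br X (middle Y) = br X Y"
  using assms br_top[OF assms(1) f_E] by (simp add: middle_def br_right.diff)

lemma lie_algebra_middle: "lie_algebra_on s middle_space middle_br"
proof unfold_locales
  show "subspace middle_space"
    by (rule subspaceI) (auto simp: middle_space_def E.zero E_add E_scale)
  show "bilinear_on s s middle_space middle_space middle_br"
    by (auto simp: bilinear_on_def linear_on_def middle_br_def br_add_left br_add_right
        br_scale_left br_scale_right middle.add middle_scale)
  show "middle_br X X = 0" for X
    using alternating[of X] by (simp add: middle_br_def middle.zero)
  fix X Y Z assume "X \<in> middle_space" "Y \<in> middle_space" "Z \<in> middle_space"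
  hence 0: "E 0 X = 0" "E 0 Y = 0" "E 0 Z = 0"
    by (simp_all add: middle_space_def)
  \<comment> \<open>Without its inner projections the sum is \<open>middle\<close> applied to the
    Jacobi sum of \<open>br\<close>.\<close>
  show "middle_br X (middle_br Y Z) + middle_br Y (middle_br Z X) + middle_br Z (middle_br X Y) = 0"
    using jacobi[of X Y Z]
    by (simp add: middle_br_def 0 middle_br_middle E_0_br middle.zero flip: middle.add)
qed

lemma lie_algebra_ker: "lie_algebra_on s {X. N X = 0} br"
proof unfold_locales
  show "subspace {X. N X = 0}"
    by (rule subspaceI) (auto simp: N.zero N.add N_scale)
  show "bilinear_on s s {X. N X = 0} {X. N X = 0} br"
    by (auto simp: bilinear_on_def linear_on_def br_add_left br_add_right br_scale_left
        br_scale_right N_br br_left.zero br_right.zero)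
qed (simp_all add: alternating jacobi)

text \<open>By \<open>g_middle\<close> the projection is invisible to \<open>g\<close> against
  \<open>middle_space\<close>, so ad-invariance and nondegeneracy are inherited.\<close>

lemma metric_middle: "ad_invariant_metric_on s middle_space middle_br g"
  unfolding ad_invariant_metric_on_def ad_invariant_form_on_def
proof (intro conjI ballI impI)
  show "bilinear_on s (*) middle_space UNIV g"
    by (auto simp: bilinear_on_def linear_on_def g_add_left g_add_right g_scale_left g_scale_right)
  show "g X Y = g Y X" for X Y
    by (rule g_commute)
  show "g (middle_br X Y) Z = - g Y (middle_br X Z)"
    if "Y \<in> middle_space" "Z \<in> middle_space" for X Y Z
    using that by (simp add: middle_br_def g_middle g_commute[of Y] g_ad)
  fix X assume X: "X \<in> middle_space" "\<forall>Y\<in>middle_space. g X Y = 0"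
  hence "g X Y = 0" for Y
    using g_middle[OF X(1), of Y] by (metis g_commute middle_in)
  thus "X = 0"
    by (rule g_nondegenerate)
qed

text \<open>The kernel acts by \<open>br\<close>: this action commutes with \<open>middle\<close>,
  so it derives \<open>middle_br\<close>, and ad-invariance of \<open>g\<close> makes it
  skew.\<close>

lemma double_extension_ker_middle:
  "double_extension_data s {X. N X = 0} br s middle_space middle_br g br (\<lambda>A B. 0)"
proof (intro double_extension_data.intro double_extension_data_axioms.intro
    lie_algebra_ker lie_algebra_middle metric_middle)
  show "ad_invariant_form_on s {X. N X = 0} br (\<lambda>A B. 0 :: 'k)"
    by (simp add: ad_invariant_form_on_def bilinear_on_def linear_on_def)
  show "br A \<in> derivations_on s middle_space middle_br \<inter> so_on s middle_space g"
    if "A \<in> {X. N X = 0}" for A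
  proof -
    have A: "N A = 0" using that by simp
    have "linear_on s s middle_space middle_space (br A)"
      using br_ker_middle[OF A] by (auto simp: linear_on_def br_add_right br_scale_right)
    moreover have "br A (middle_br X Y) = middle_br (br A X) Y + middle_br X (br A Y)" for X Y
      unfolding middle_br_def middle_br_ker[OF A, symmetric] br_leibniz[of A X Y] by (rule middle.add)
    moreover have "g (br A X) Y + g X (br A Y) = 0" for X Y
      by (simp add: g_ad)
    ultimately show ?thesis
      by (simp add: derivations_on_def so_on_def)
  qed
  show "linear_on s s {X. N X = 0} middle_space (\<lambda>A. br A X)" if "X \<in> middle_space" for X
    using that by (auto simp: linear_on_def br_add_left br_scale_left br_ker_middle)
  show "br (br A B) X = br A (br B X) - br B (br A X)" for A B X
    using br_leibniz[of A B X] by simp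
qed

section \<open>The isometric isomorphism onto the double extension\<close>

text \<open>The third entry identifies the \<open>l\<close>-eigenspace with the dual of the kernel:
  by \<open>g_ker\<close> it depends on \<open>E l X\<close> only. The value 0 off the kernel is the
  convention of \<open>dual_space\<close>.\<close>

definition dext_iso :: "'a \<Rightarrow> 'a \<times> 'a \<times> ('a \<Rightarrow> 'k)"
  where "dext_iso X = (E 0 X, middle X, \<lambda>C. if N C = 0 then g X C else 0)"

lemma decompose: "X = E 0 X + middle X + E l X"
  by (simp add: middle_def)

lemma dext_iso_in: "dext_iso X \<in> dext_carrier s {X. N X = 0} middle_space"
  by (auto simp: dext_iso_def dext_carrier_def dual_space_def linear_on_def N_E_0 N.add N_scale
      g_add_right g_scale_right)

text \<open>The difference \<open>Z\<close> lies in the \<open>l\<close>-eigenspace, which pairs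
  only with the kernel, and it is orthogonal to the kernel.\<close>

lemma inj_dext_iso: "inj dext_iso"
proof (rule injI)
  fix X Y assume eq: "dext_iso X = dext_iso Y"
  define Z where "Z = X - Y"
  have "E 0 Z = 0" "middle Z = 0"
    using eq by (simp_all add: Z_def dext_iso_def E.diff middle.diff)
  hence Z: "N Z = s l Z"
    using decompose[of Z] f_E[of l Z] by simp
  have ker: "g Z C = 0" if "N C = 0" for C
    using eq that by (simp add: Z_def dext_iso_def g_left.diff) (metis)
  have "g Z C = 0" for C
    using g_top[OF Z, of C] ker[OF N_E_0, of C] by (simp add: g_commute)
  hence "Z = 0"
    by (rule g_nondegenerate)
  thus "X = Y" by (simp add: Z_def)
qed

lemma surj_dext_iso:
  assumes "P \<in> dext_carrier s {X. N X = 0} middle_space"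
  shows "P \<in> range dext_iso"
proof -
  obtain A X \<alpha> where P: "P = (A, X, \<alpha>)" and A: "N A = 0" and X: "X \<in> middle_space"
    and \<alpha>: "linear_on s (*) {X. N X = 0} UNIV \<alpha>" "\<And>C. N C \<noteq> 0 \<Longrightarrow> \<alpha> C = 0"
    using assms by (cases P) (auto simp: dext_carrier_def dual_space_def)
  \<comment> \<open>Precomposing with \<open>E 0\<close> extends \<alpha> linearly from the kernel
    to the whole space, as \<open>riesz\<close> requires.\<close>
  have "Vector_Spaces.linear s (*) (\<lambda>Y. \<alpha> (E 0 Y))"
    using \<alpha>(1) vector_space_axioms
    by (auto simp: Vector_Spaces.linear_iff linear_on_def E_add E_scale N_E_0 vector_space_def algebra_simps)
  then obtain Z where Z: "\<And>Y. g Z Y = \<alpha> (E 0 Y)"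
    using riesz[of "\<lambda>Y. \<alpha> (E 0 Y)"] by blast
  \<comment> \<open>Only the \<open>l\<close>-component of \<open>Z\<close> is kept: it has the same
    pairing with the kernel and leaves the first two entries untouched.\<close>
  define W where "W = A + X + E l Z"
  have E: "E 0 W = A" "E l W = E l Z"
    using A X l_nonzero by (simp_all add: W_def E_add E_E E_ker middle_space_def)
  hence "middle W = X"
    by (simp add: middle_def W_def)
  moreover have "g W C = \<alpha> C" if "N C = 0" for C
    using g_ker[OF that, of W] g_ker[OF that, of Z] E(2) Z[of C] that by (simp add: E_ker)
  ultimately have "dext_iso W = P"
    using E \<alpha>(2) by (auto simp: dext_iso_def P)
  thus ?thesis by blast
qed

text \<open>The three components of \<open>Y\<close> pair with \<open>E l X\<close>,
  \<open>middle X\<close> and \<open>E 0 X\<close> respectively. The kernel is isotropic since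
  \<open>l \<noteq> 0\<close>, which matches the zero form on it.\<close>

lemma dext_iso_metric: "dext_metric (\<lambda>A B. 0) g (dext_iso X) (dext_iso Y) = g X Y"
proof -
  have "g X Y = g X (E 0 Y) + g X (middle Y) + g X (E l Y)"
    by (subst decompose[of Y]) (simp only: g_add_right)
  moreover have "g X (middle Y) = g (middle X) (middle Y)"
    by (simp add: g_middle)
  moreover have "g X (E l Y) = g Y (E 0 X)"
    using g_top[OF f_E, of X Y] g_ker[OF N_E_0, of Y X] by (simp add: g_commute)
  ultimately show ?thesis
    by (simp add: dext_metric_def dext_iso_def N_E_0)
qed

text \<open>After the kernel components are split off, every bracket involving \<open>X'\<close> or
  \<open>Y'\<close> has no kernel component.\<close>

lemma E_0_br_eq: "E 0 (br X Y) = br (E 0 X) (E 0 Y)"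
proof -
  define X' where "X' = X - E 0 X"
  define Y' where "Y' = Y - E 0 Y"
  have X': "E 0 X' = 0" and Y': "E 0 Y' = 0"
    by (simp_all add: X'_def Y'_def E.diff E_E)
  have "br X Y = br (E 0 X) Y - br (E 0 Y) X' + br X' Y'"
    using br_commute[of X' "E 0 Y"] br_left.diff[of X "E 0 X" Y] br_right.diff[of X' Y "E 0 Y"]
    by (simp flip: X'_def Y'_def)
  thus ?thesis
    using X' Y' by (simp add: E_add E.diff E_br_ker N_E_0 br_right.zero E_0_br)
qed

lemma middle_br_eq:
  "middle (br X Y) = middle_br (middle X) (middle Y) + br (E 0 X) (middle Y) - br (E 0 Y) (middle X)"
proof -
  define X' where "X' = X - E 0 X"
  define Y' where "Y' = Y - E 0 Y"
  have X': "E 0 X' = 0" and Y': "E 0 Y' = 0"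
    by (simp_all add: X'_def Y'_def E.diff E_E)
  have m: "middle X' = middle X" "middle Y' = middle Y"
    by (simp_all add: X'_def Y'_def middle.diff middle_ker N_E_0)
  have m0: "E 0 (middle Z) = 0" for Z
    using middle_in[of Z] by (simp add: middle_space_def)
  \<comment> \<open>\<open>X'\<close> and \<open>Y'\<close> differ from the middle parts by
    \<open>l\<close>-components, which are dropped in one argument at a time.\<close>
  have "br X' Y' = br (middle X) (middle Y)"
    using middle_br_middle[OF X' Y'] middle_br_middle[OF m0 X', of Y]
      br_commute[of X' "middle Y"] br_commute[of "middle X" "middle Y"] by (simp add: m)
  moreover have "br X Y = br (E 0 X) Y - br (E 0 Y) X' + br X' Y'"
    using br_commute[of X' "E 0 Y"] br_left.diff[of X "E 0 X" Y] br_right.diff[of X' Y "E 0 Y"]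
    by (simp flip: X'_def Y'_def)
  ultimately show ?thesis
    by (simp add: middle.add middle.diff middle_br_ker N_E_0 middle_br_def m)
qed

text \<open>This is the dual entry of the bracket. Moving \<open>C\<close> across gives
  \<open>g (br C X) Y\<close>; the middle component of \<open>Y\<close> then yields the cocycle, the
  two outer ones the coadjoint terms.\<close>

lemma g_br_ker:
  assumes C: "N C = 0"
  shows "g (br X Y) C =
    g (br C (middle X)) (middle Y) - g Y (br (E 0 X) C) + g X (br (E 0 Y) C)"
proof -
  have "g (br X Y) C = g (br C X) Y"
    using g_ad[of X Y C] br_commute[of C X] g_commute[of Y "br X C"] by (simp add: g_left.minus)
  also have "\<dots> = g (br C X) (E 0 Y) + g (br C X) (middle Y) + g (br C X) (E l Y)"
    by (subst decompose[of Y]) (simp only: g_add_right)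
  also have "g (br C X) (E 0 Y) = g X (br (E 0 Y) C)"
    using g_ad[of C X "E 0 Y"] br_commute[of C "E 0 Y"] by (simp add: g_right.minus)
  also have "g (br C X) (middle Y) = g (br C (middle X)) (middle Y)"
    by (simp add: g_middle C flip: middle_br_ker)
  \<comment> \<open>The \<open>l\<close>-component of \<open>Y\<close> sees only the kernel
    component of \<open>br C X\<close>, which is \<open>br C (E 0 X)\<close>.\<close>
  also have "g (br C X) (E l Y) = g (E l Y) (br C (E 0 X))"
    using g_top[OF f_E, of "br C X" Y] by (simp add: E_br_ker C g_commute)
  also have "\<dots> = - g Y (br (E 0 X) C)"
  proof -
    have "N (br C (E 0 X)) = 0"
      by (simp add: N_br C N_E_0 br_left.zero br_right.zero)
    hence "g (E l Y) (br C (E 0 X)) = g Y (br C (E 0 X))"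
      by (rule g_ker[symmetric])
    thus ?thesis
      by (simp add: br_commute[of C "E 0 X"] g_right.minus)
  qed
  finally show ?thesis by simp
qed

text \<open>The facts on \<open>N\<close> show that the kernel is closed under \<open>br\<close>, so
  the functionals extended by 0 are evaluated where they agree with \<open>g\<close>.\<close>

lemma dext_iso_br:
  "dext_iso (br X Y) = dext_bracket {X. N X = 0} br middle_br g br (dext_iso X) (dext_iso Y)"
  by (auto simp: dext_iso_def dext_bracket_def dext_cocycle_def coadjoint_def fun_eq_iff
      E_0_br_eq middle_br_eq g_br_ker N_br N_E_0 br_left.zero br_right.zero)

lemma metric_lie_isomorphism_dext_iso:
  "metric_lie_isomorphism s UNIV br g
    (dext_scale s s) (dext_carrier s {X. N X = 0} middle_space)
    (dext_bracket {X. N X = 0} br middle_br g br) (dext_metric (\<lambda>A B. 0) g) dext_iso"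
  unfolding metric_lie_isomorphism_def
proof (intro conjI ballI)
  show "linear_on s (dext_scale s s) UNIV (dext_carrier s {X. N X = 0} middle_space) dext_iso"
    using dext_iso_in
    by (auto simp: linear_on_def dext_iso_def dext_scale_def fun_eq_iff E_add E_scale middle.add
        middle_scale g_add_left g_scale_left)
  show "bij_betw dext_iso UNIV (dext_carrier s {X. N X = 0} middle_space)"
    using inj_dext_iso surj_dext_iso dext_iso_in by (auto simp: bij_betw_def)
qed (simp_all add: dext_iso_br dext_iso_metric)

end

theorem proposition6p5:
  fixes s :: "'k::real_or_complex \<Rightarrow> 'a::ab_group_add \<Rightarrow> 'a"
    and Basis :: "'a set"
    and br :: "'a \<Rightarrow> 'a \<Rightarrow> 'a"
    and g :: "'a \<Rightarrow> 'a \<Rightarrow> 'k"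
    and N :: "'a \<Rightarrow> 'a"
  assumes "finite_dimensional_vector_space s Basis"
    and "lie_algebra_on s UNIV br"
    and "ad_invariant_metric_on s UNIV br g"
    and "metric_nikolayevsky_derivation s br g N"
    and "N \<noteq> (\<lambda>X. 0)"
    and "\<not> bij N"
    and "\<And>\<mu>. complex_eigenvalue s N \<mu> \<Longrightarrow> \<mu> \<in> \<real> \<and> 0 \<le> Re \<mu>"
  shows "\<exists>(D :: 'a set) brD gD \<pi> \<Phi>.
    double_extension_data s {X. N X = 0} br s D brD gD \<pi> (\<lambda>A B. 0) \<and>
    metric_lie_isomorphism s UNIV br g
      (dext_scale s s) (dext_carrier s {X. N X = 0} D) (dext_bracket {X. N X = 0} br brD gD \<pi>)
      (dext_metric (\<lambda>A B. 0) gD) \<Phi>"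
proof -
  interpret V: finite_dimensional_vector_space s Basis by fact
  interpret L: lie_algebra_on s UNIV br by fact
  interpret hom: field_hom "to_complex :: 'k \<Rightarrow> complex" by (rule field_hom_to_complex)
  have N: "N \<in> derivations_on s UNIV br" "N \<in> co_on s UNIV g" "semisimple_endo s N"
    using assms(4) by (auto simp: metric_nikolayevsky_derivation_def)
  then obtain l where l: "\<And>X Y. g (N X) Y + g X (N Y) = l * g X Y"
    by (auto simp: co_on_def)
  have lin: "Vector_Spaces.linear s s N"
    using N(1) V.vector_space_axioms by (auto simp: Vector_Spaces.linear_iff derivations_on_def linear_on_def)
  \<comment> \<open>The eigenvalues are real by hypothesis, so they lie in the image of the ground
    field in either case.\<close>
  have "\<real> \<subseteq> range (to_complex :: 'k \<Rightarrow> complex)"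
    using range_to_complex[where 'a='k] by auto
  then obtain S E where E: "eigen_projections s N S E"
    and S: "\<And>a. a \<in> S \<Longrightarrow> complex_eigenvalue s N (to_complex a)"
    using semisimple_endo_eigen_projections[OF assms(1) lin N(3)] assms(7) by blast
  interpret E: eigen_projections s N S E by fact
  \<comment> \<open>The real part serves as weight: it is additive, and nonzero on nonzero
    eigenvalues because these are real.\<close>
  interpret W: weighted_metric_lie_algebra s Basis br N S E g l "\<lambda>a. Re (to_complex a)"
  proof
    fix a assume "a \<in> S"
    with assms(7) S have a: "to_complex a \<in> \<real>" "0 \<le> Re (to_complex a)"
      by blast+
    thus "0 \<le> Re (to_complex a)" by simp
    show "Re (to_complex a) \<noteq> 0" if "a \<noteq> 0"
    proof -
      have "to_complex a \<noteq> 0" using that by simp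
      thus ?thesis using a(1) by (auto simp: complex_is_Real_iff complex_eq_iff)
    qed
  qed (use assms(3,5) N(1) l in \<open>simp_all add: hom.hom_add\<close>)
  show ?thesis
    \<comment> \<open>The witnesses are \<open>middle_space\<close>, \<open>middle_br\<close>,
      \<open>g\<close>, \<open>br\<close> and \<open>dext_iso\<close>.\<close>
    using W.double_extension_ker_middle W.metric_lie_isomorphism_dext_iso by blast
qed

end
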